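(* Let $n \geqslant m \geqslant 1$ be integers and let $\sigma^m = [\upsilon^0, \upsilon^1, \ldots, \upsilon^m]$ be an $m$-simplex in $\mathbb{R}^n$. For $i=0,1,\ldots,m$, let $\kappa_i^m$ be the barycenter of the $i$-th $(m-1)$-face of $\sigma^m$ (the one opposite to $\upsilon^i$) and let $\mu_i^m = [\kappa_i^m, \upsilon^i]$ be the $i$-th median, with length $\|\mu_i^m\|$. Then $$m\sum_{\substack{j=0\\ j\neq i}}^{m} \|\upsilon^i-\upsilon^j\|^2 = \sum_{\substack{p=0\\ p\neq i}}^{m-1}\ \sum_{\substack{q=p+1\\ q\neq i}}^{m} \|\upsilon^p-\upsilon^q\|^2 + m^2\,\|\mu_i^m\|^2,\qquad i=0,1,\ldots,m.$$
   Context: An $m$-simplex $[\upsilon^0,\ldots,\upsilon^m]$ in $\mathbb{R}^n$ is the convex hull of $m+1$ affinely independent points (its vertices). The $i$-th $(m-1)$-face is the convex hull of all vertices except $\upsilon^i$, and its barycenter is $\kappa_i^m = \frac1m\sum_{j\neq i}\upsilon^j$. The $i$-th median $\mu_i^m$ is the segment joining $\upsilon^i$ and $\kappa_i^m$, and $\|\mu_i^m\| = \|\kappa_i^m-\upsilon^i\|$ is its length, where $\|\cdot\|$ is the Euclidean norm. *)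

theory Defs
  imports "HOL-Analysis.Analysis"
begin

text \<open>Vertices are an indexed family, of which only the values at \<open>0, \<dots>, m\<close> matter;
  the library's \<^const>\<open>simplex\<close> does not record an enumeration of the vertices.
  Injectivity is needed because \<^const>\<open>affine_dependent\<close> is a property of sets and so
  ignores repetitions.\<close>

definition simplex_with_vertices ::
    "nat \<Rightarrow> (nat \<Rightarrow> 'a::euclidean_space) \<Rightarrow> 'a set \<Rightarrow> bool" where
  "simplex_with_vertices m v S \<longleftrightarrow>
     inj_on v {0..m} \<and> \<not> affine_dependent (v ` {0..m}) \<and> S = convex hull (v ` {0..m})"

lemma simplex_with_vertices_imp_simplex:
  "simplex_with_vertices m v S \<Longrightarrow> int m simplex S"
  unfolding simplex_with_vertices_def simplex_def
  by (intro exI[of _ "v ` {0..m}"]) (simp add: card_image)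

definition face_barycenter :: "nat \<Rightarrow> (nat \<Rightarrow> 'a::euclidean_space) \<Rightarrow> nat \<Rightarrow> 'a" where
  "face_barycenter m v i = (1 / real m) *\<^sub>R (\<Sum>j\<in>{0..m} - {i}. v j)"

definition median :: "nat \<Rightarrow> (nat \<Rightarrow> 'a::euclidean_space) \<Rightarrow> nat \<Rightarrow> 'a set" where
  "median m v i = closed_segment (face_barycenter m v i) (v i)"

definition median_length :: "nat \<Rightarrow> (nat \<Rightarrow> 'a::euclidean_space) \<Rightarrow> nat \<Rightarrow> real" where
  "median_length m v i = norm (face_barycenter m v i - v i)"

lemma median_length_eq_diameter: "median_length m v i = diameter (median m v i)"
proof (rule antisym)
  let ?k = "face_barycenter m v i"
  show "median_length m v i \<le> diameter (median m v i)"
    unfolding median_length_def median_def dist_norm [symmetric]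
    by (rule diameter_bounded_bound) (auto simp: compact_imp_bounded compact_segment)
  show "diameter (median m v i) \<le> median_length m v i"
    unfolding median_length_def median_def
  proof (rule diameter_le)
    fix x y assume "x \<in> closed_segment ?k (v i)" "y \<in> closed_segment ?k (v i)"
    then obtain s t where s: "x = (1 - s) *\<^sub>R ?k + s *\<^sub>R v i" "0 \<le> s" "s \<le> 1"
      and t: "y = (1 - t) *\<^sub>R ?k + t *\<^sub>R v i" "0 \<le> t" "t \<le> 1"
      by (auto simp: closed_segment_def)
    have "x - y = (t - s) *\<^sub>R (?k - v i)"
      unfolding s(1) t(1) by (simp add: algebra_simps)
    then have "norm (x - y) = \<bar>t - s\<bar> * norm (?k - v i)"
      by simp
    also have "\<dots> \<le> 1 * norm (?k - v i)"
      by (rule mult_right_mono) (use s t in auto)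
    finally show "norm (x - y) \<le> norm (?k - v i)"
      by simp
  qed simp
qed

end

theory Submission
  imports Defs
begin

text \<open>Put the vertex \<open>\<upsilon>\<^sup>i\<close> at the origin. The median vector scaled by \<open>m\<close> becomes the sum of the
  other \<open>m\<close> vertices, and the claim is Lagrange's identity
  \<open>m \<Sum> |w\<^sub>p|\<^sup>2 = \<Sum>\<^bsub>p<q\<^esub> |w\<^sub>p - w\<^sub>q|\<^sup>2 + |\<Sum> w\<^sub>p|\<^sup>2\<close>
  for \<open>m\<close> vectors of an inner product space.\<close>

lemma sum_dist_pairs:
  fixes w :: "'b::linorder \<Rightarrow> 'a::real_inner"
  assumes "finite A"
  shows "real (card A) * (\<Sum>p\<in>A. (norm (w p))\<^sup>2)
    = (\<Sum>p\<in>A. \<Sum>q\<in>{q\<in>A. p < q}. (norm (w p - w q))\<^sup>2) + (norm (\<Sum>p\<in>A. w p))\<^sup>2"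
  using assms
\<comment> \<open>Adding elements in increasing order makes the new index \<open>b\<close> the
  larger one in every new pair, so exactly one pair \<open>(p, b)\<close> arises for each
  \<open>p\<close> in \<open>A\<close>.\<close>
proof (induction A rule: finite_linorder_max_induct)
  case empty
  then show ?case by simp
next
  case (insert b A)
  let ?pairs = "\<lambda>B. \<Sum>p\<in>B. \<Sum>q\<in>{q\<in>B. p < q}. (norm (w p - w q))\<^sup>2"
  have notin: "b \<notin> A" using insert.hyps(2) by blast
  have above_b: "{q \<in> insert b A. b < q} = {}"
    using insert.hyps(2) by fastforce
  have above: "{q \<in> insert b A. p < q} = insert b {q\<in>A. p < q}" if "p \<in> A" for p
    using insert.hyps(2) that by auto
  have "?pairs (insert b A)
      = (\<Sum>p\<in>A. \<Sum>q\<in>{q \<in> insert b A. p < q}. (norm (w p - w q))\<^sup>2)"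
    by (subst sum.insert[OF insert.hyps(1) notin], subst above_b) simp
  also have "\<dots> = (\<Sum>p\<in>A. (norm (w p - w b))\<^sup>2 + (\<Sum>q\<in>{q\<in>A. p < q}. (norm (w p - w q))\<^sup>2))"
    using insert.hyps(1) notin by (intro sum.cong refl) (simp only: above, simp)
  also have "\<dots> = (\<Sum>p\<in>A. (norm (w p - w b))\<^sup>2) + ?pairs A"
    by (rule sum.distrib)
  finally have pairs: "?pairs (insert b A) = (\<Sum>p\<in>A. (norm (w p - w b))\<^sup>2) + ?pairs A" .
  have new: "(\<Sum>p\<in>A. (norm (w p - w b))\<^sup>2)
      = (\<Sum>p\<in>A. (norm (w p))\<^sup>2) + real (card A) * (norm (w b))\<^sup>2 - 2 * inner (w b) (\<Sum>p\<in>A. w p)"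
    by (simp add: power2_norm_eq_inner inner_diff_left inner_diff_right inner_commute
        inner_sum_right sum.distrib sum_subtractf sum_distrib_left algebra_simps)
  have total: "(norm (w b + (\<Sum>p\<in>A. w p)))\<^sup>2
      = (norm (w b))\<^sup>2 + 2 * inner (w b) (\<Sum>p\<in>A. w p) + (norm (\<Sum>p\<in>A. w p))\<^sup>2"
    by (simp add: power2_norm_eq_inner inner_add_left inner_add_right inner_commute)
  \<comment> \<open>The cross terms in \<open>new\<close> and \<open>total\<close> cancel. What is
    left beyond the induction hypothesis is the growth of the left side when both the cardinality
    and the sum gain a term.\<close>
  show ?case
    unfolding pairs new
    using insert.IH insert.hyps(1) notin total by (simp add: algebra_simps)
qed

theorem theorem2p17:
  fixes m :: nat
    and v :: "nat \<Rightarrow> real ^ 'n"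
    and S :: "(real ^ 'n) set"
  assumes "1 \<le> m" and "m \<le> CARD('n)"
    and "simplex_with_vertices m v S"
  shows "\<forall>i\<in>{0..m}.
    real m * (\<Sum>j\<in>{0..m} - {i}. (norm (v i - v j))\<^sup>2)
      = (\<Sum>p\<in>{0..m-1} - {i}. \<Sum>q\<in>{p+1..m} - {i}. (norm (v p - v q))\<^sup>2)
        + (real m)\<^sup>2 * (median_length m v i)\<^sup>2"
proof
  fix i assume i: "i \<in> {0..m}"
  define A where "A = {0..m} - {i}"
  have card: "card A = m" using i by (simp add: A_def)
  have above: "{p+1..m} - {i} = {q\<in>A. p < q}" for p by (auto simp: A_def)
  have pairs: "(\<Sum>p\<in>{0..m-1} - {i}. \<Sum>q\<in>{p+1..m} - {i}. (norm (v p - v q))\<^sup>2)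
      = (\<Sum>p\<in>A. \<Sum>q\<in>{q\<in>A. p < q}. (norm (v p - v q))\<^sup>2)"
    unfolding above
  \<comment> \<open>The only index of \<open>A\<close> that \<open>{0..m-1} - {i}\<close> can miss
    is \<open>m\<close>, and no larger \<open>q\<close> exists for it.\<close>
  proof (rule sum.mono_neutral_left)
    show "\<forall>p\<in>A - ({0..m-1} - {i}). (\<Sum>q\<in>{q\<in>A. p < q}. (norm (v p - v q))\<^sup>2) = 0"
    proof
      fix p assume "p \<in> A - ({0..m-1} - {i})"
      then have "{q\<in>A. p < q} = {}" by (auto simp: A_def)
      then show "(\<Sum>q\<in>{q\<in>A. p < q}. (norm (v p - v q))\<^sup>2) = 0" by (simp only: sum.empty)
    qed
  qed (auto simp: A_def)
  \<comment> \<open>\<open>v i\<close> is subtracted once for each of the \<open>m\<close> elements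
    of \<open>A\<close>; \<open>1 \<le> m\<close> lets the factor \<open>m\<close> cancel the
    \<open>1 / m\<close> of the barycenter.\<close>
  have "(\<Sum>j\<in>A. v j - v i) = real m *\<^sub>R (face_barycenter m v i - v i)"
    using \<open>1 \<le> m\<close> card
    by (simp add: face_barycenter_def sum_subtractf scaleR_diff_right sum_constant_scaleR
        del: sum_constant flip: A_def)
  then have med: "(norm (\<Sum>j\<in>A. v j - v i))\<^sup>2 = (real m)\<^sup>2 * (median_length m v i)\<^sup>2"
    by (simp add: median_length_def power_mult_distrib)
  have "finite A" by (simp add: A_def)
  \<comment> \<open>The translation by \<open>v i\<close> drops out of the pairwise
    differences.\<close>
  from sum_dist_pairs[OF this, of "\<lambda>j. v j - v i"]
  show "real m * (\<Sum>j\<in>{0..m} - {i}. (norm (v i - v j))\<^sup>2)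
      = (\<Sum>p\<in>{0..m-1} - {i}. \<Sum>q\<in>{p+1..m} - {i}. (norm (v p - v q))\<^sup>2)
        + (real m)\<^sup>2 * (median_length m v i)\<^sup>2"
    unfolding pairs med card by (simp add: norm_minus_commute flip: A_def)
qed

end
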